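(* There is a unique homomorphism of common meadows $f:\mathbb{F}_{cm}(\mathbb Z)\to\mathbb Q_{\mathbf a}$, and it is surjective but not injective. Thus the common meadow $\mathbb{F}_{cm}(\mathbb Z)$ is a proper homomorphic pre-image of $\mathbb Q_{\mathbf a}$.
   Context: Let $\Sigma_{cm}=\{0,1,\mathbf a,-(\_),(\_)^{-1},+,\cdot\}$ (three constants, two unary and two binary operations). Let $F(\mathbb Z)=\mathbb Z\times\mathbb Z$, whose elements are called fracpairs and written $\frac pq$ (with $q=0$ allowed). Cc-equivalence $=_{cc}$ is the smallest equivalence relation on $F(\mathbb Z)$ such that $\frac{x\cdot z}{y\cdot(z\cdot z)}=_{cc}\frac{x}{y\cdot z}$ for all $x,y,z\in\mathbb Z$. On $F(\mathbb Z)$ define: $\frac xy+\frac uv=\frac{x\cdot v+u\cdot y}{y\cdot v}$, $\frac xy\cdot\frac uv=\frac{x\cdot u}{y\cdot v}$, $-\frac xy=\frac{-x}{y}$, $\left(\frac xy\right)^{-1}=\frac{y\cdot y}{x\cdot y}$, $0=\frac01$, $1=\frac11$, $\mathbf a=\frac10$. The relation $=_{cc}$ is a congruence for these operations, and $\mathbb{F}_{cm}(\mathbb Z)$ is the quotient $\Sigma_{cm}$-algebra $F(\mathbb Z)/{=_{cc}}$. $\mathbb Q_{\mathbf a}$ is the $\Sigma_{cm}$-algebra with domain $\mathbb Q\cup\{\mathbf a\}$, $\mathbf a\notin\mathbb Q$, with the usual field operations on $\mathbb Q$ (with the usual inverse of nonzero rationals), $0^{-1}=\mathbf a$, $-\mathbf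 a=\mathbf a^{-1}=\mathbf a$, and $x+\mathbf a=\mathbf a+x=x\cdot\mathbf a=\mathbf a\cdot x=\mathbf a$ for all $x$. Both $\mathbb{F}_{cm}(\mathbb Z)$ and $\mathbb Q_{\mathbf a}$ are common meadows, that is, $\Sigma_{cm}$-algebras satisfying, for all $x,y,z$: $(x+y)+z=x+(y+z)$; $x+y=y+x$; $x+0=x$; $x+(-x)=0\cdot x$; $(x\cdot y)\cdot z=x\cdot(y\cdot z)$; $x\cdot y=y\cdot x$; $1\cdot x=x$; $x\cdot(y+z)=x\cdot y+x\cdot z$; $-(-x)=x$; $0\cdot(x\cdot x)=0\cdot x$; $(x^{-1})^{-1}=x+0\cdot x^{-1}$; $x\cdot x^{-1}=1+0\cdot x^{-1}$; $(x\cdot y)^{-1}=x^{-1}\cdot y^{-1}$; $1^{-1}=1$; $0^{-1}=\mathbf a$; $x+\mathbf a=\mathbf a$; $x\cdot\mathbf a=\mathbf a$. A homomorphism of common meadows is a map preserving all constants and operations of $\Sigma_{cm}$. *)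

theory Defs
  imports Complex_Main
begin

record 'a cm_algebra =
  cm_zero :: 'a  ("\<zero>\<index>")
  cm_one  :: 'a  ("\<one>\<index>")
  cm_err  :: 'a  ("\<a>\<index>")
  cm_neg  :: "'a \<Rightarrow> 'a"  ("\<ominus>\<index> _" [81] 80)
  cm_inv  :: "'a \<Rightarrow> 'a"  ("inv\<index> _" [81] 80)
  cm_add  :: "'a \<Rightarrow> 'a \<Rightarrow> 'a"  (infixl "\<oplus>\<index>" 65)
  cm_mult :: "'a \<Rightarrow> 'a \<Rightarrow> 'a"  (infixl "\<otimes>\<index>" 70)

text \<open>Algebras carry no carrier set: the domain is the whole type \<open>'a\<close>.\<close>

locale common_meadow =
  fixes M :: "'a cm_algebra" (structure)
  assumes add_assoc: "(x \<oplus> y) \<oplus> z = x \<oplus> (y \<oplus> z)"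
    and add_comm: "x \<oplus> y = y \<oplus> x"
    and add_zero: "x \<oplus> \<zero> = x"
    and add_neg: "x \<oplus> (\<ominus> x) = \<zero> \<otimes> x"
    and mult_assoc: "(x \<otimes> y) \<otimes> z = x \<otimes> (y \<otimes> z)"
    and mult_comm: "x \<otimes> y = y \<otimes> x"
    and one_mult: "\<one> \<otimes> x = x"
    and distrib: "x \<otimes> (y \<oplus> z) = x \<otimes> y \<oplus> x \<otimes> z"
    and neg_neg: "\<ominus> (\<ominus> x) = x"
    and zero_mult_square: "\<zero> \<otimes> (x \<otimes> x) = \<zero> \<otimes> x"
    and inv_inv: "inv (inv x) = x \<oplus> \<zero> \<otimes> inv x"
    and mult_inv: "x \<otimes> inv x = \<one> \<oplus> \<zero> \<otimes> inv x"
    and inv_mult: "inv (x \<otimes> y) = inv x \<otimes> inv y"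
    and inv_one: "inv \<one> = \<one>"
    and inv_zero: "inv \<zero> = \<a>"
    and add_err: "x \<oplus> \<a> = \<a>"
    and mult_err: "x \<otimes> \<a> = \<a>"

locale common_meadow_hom =
  source: common_meadow M + target: common_meadow N
  for M :: "'a cm_algebra" and N :: "'b cm_algebra" +
  fixes f :: "'a \<Rightarrow> 'b"
  assumes hom_zero: "f \<zero>\<^bsub>M\<^esub> = \<zero>\<^bsub>N\<^esub>"
    and hom_one: "f \<one>\<^bsub>M\<^esub> = \<one>\<^bsub>N\<^esub>"
    and hom_err: "f \<a>\<^bsub>M\<^esub> = \<a>\<^bsub>N\<^esub>"
    and hom_neg: "f (\<ominus>\<^bsub>M\<^esub> x) = \<ominus>\<^bsub>N\<^esub> f x"
    and hom_inv: "f (inv\<^bsub>M\<^esub> x) = inv\<^bsub>N\<^esub> f x"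
    and hom_add: "f (x \<oplus>\<^bsub>M\<^esub> y) = f x \<oplus>\<^bsub>N\<^esub> f y"
    and hom_mult: "f (x \<otimes>\<^bsub>M\<^esub> y) = f x \<otimes>\<^bsub>N\<^esub> f y"

definition proper_hom_preimage :: "'a cm_algebra \<Rightarrow> 'b cm_algebra \<Rightarrow> bool" where
  "proper_hom_preimage M N \<longleftrightarrow> (\<exists>f. common_meadow_hom M N f \<and> surj f \<and> \<not> inj f)"

text \<open>A fracpair \<open>p/q\<close> is the pair \<open>(p, q)\<close>; the denominator may be zero.\<close>

type_synonym fracpair = "int \<times> int"

inductive cc_eq :: "fracpair \<Rightarrow> fracpair \<Rightarrow> bool" where
  cancel: "cc_eq (x * z, y * (z * z)) (x, y * z)"
| refl: "cc_eq p p"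
| sym: "cc_eq p q \<Longrightarrow> cc_eq q p"
| trans: "cc_eq p q \<Longrightarrow> cc_eq q r \<Longrightarrow> cc_eq p r"

fun fp_add :: "fracpair \<Rightarrow> fracpair \<Rightarrow> fracpair" where
  "fp_add (x, y) (u, v) = (x * v + u * y, y * v)"

fun fp_mult :: "fracpair \<Rightarrow> fracpair \<Rightarrow> fracpair" where
  "fp_mult (x, y) (u, v) = (x * u, y * v)"

fun fp_neg :: "fracpair \<Rightarrow> fracpair" where
  "fp_neg (x, y) = (- x, y)"

fun fp_inv :: "fracpair \<Rightarrow> fracpair" where
  "fp_inv (x, y) = (y * y, x * y)"

lemma cc_eq_cancelI:
  assumes "a = x * z" "b = y * (z * z)" "c = x" "d = y * z"
  shows "cc_eq (a, b) (c, d)"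
  unfolding assms by (rule cc_eq.cancel)

lemma cc_eq_neg: "cc_eq p q \<Longrightarrow> cc_eq (fp_neg p) (fp_neg q)"
proof (induction rule: cc_eq.induct)
  case (cancel x z y)
  show ?case by (auto intro: cc_eq_cancelI[of _ "- x" z _ y])
qed (auto intro: cc_eq.intros)

lemma cc_eq_inv: "cc_eq p q \<Longrightarrow> cc_eq (fp_inv p) (fp_inv q)"
proof (induction rule: cc_eq.induct)
  case (cancel x z y)
  have "cc_eq (fp_inv (x * z, y * (z * z))) (y * y * z * z * z, x * y * z * z)"
    by (auto intro!: cc_eq_cancelI[of _ "y * y * z * z * z" z _ "x * y * z"])
  moreover have "cc_eq (y * y * z * z * z, x * y * z * z) (fp_inv (x, y * z))"
    by (auto intro!: cc_eq_cancelI[of _ "y * y * z * z" z _ "x * y"])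
  ultimately show ?case by (rule cc_eq.trans)
qed (auto intro: cc_eq.intros)

lemma fp_add_comm: "fp_add p q = fp_add q p"
  by (cases p; cases q) simp

lemma fp_mult_comm: "fp_mult p q = fp_mult q p"
  by (cases p; cases q) simp

lemma cc_eq_add_left: "cc_eq p q \<Longrightarrow> cc_eq (fp_add p r) (fp_add q r)"
proof (induction rule: cc_eq.induct)
  case (cancel x z y)
  obtain u v where r: "r = (u, v)" by fastforce
  show ?case unfolding r
    by (auto simp: algebra_simps intro!: cc_eq_cancelI[of _ "x * v + u * y * z" z _ "y * v"])
qed (auto intro: cc_eq.intros)

lemma cc_eq_mult_left: "cc_eq p q \<Longrightarrow> cc_eq (fp_mult p r) (fp_mult q r)"
proof (induction rule: cc_eq.induct)
  case (cancel x z y)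
  obtain u v where r: "r = (u, v)" by fastforce
  show ?case unfolding r
    by (auto intro!: cc_eq_cancelI[of _ "x * u" z _ "y * v"])
qed (auto intro: cc_eq.intros)

lemma cc_eq_add: "cc_eq p p' \<Longrightarrow> cc_eq q q' \<Longrightarrow> cc_eq (fp_add p q) (fp_add p' q')"
  by (metis cc_eq_add_left cc_eq.trans fp_add_comm)

lemma cc_eq_mult: "cc_eq p p' \<Longrightarrow> cc_eq q q' \<Longrightarrow> cc_eq (fp_mult p q) (fp_mult p' q')"
  by (metis cc_eq_mult_left cc_eq.trans fp_mult_comm)

quotient_type fcm_int = fracpair / cc_eq
  by (rule equivpI) (auto intro: reflpI sympI transpI cc_eq.intros)

lift_definition fcm_frac :: "int \<Rightarrow> int \<Rightarrow> fcm_int" is Pair .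
lift_definition fcm_add :: "fcm_int \<Rightarrow> fcm_int \<Rightarrow> fcm_int" is fp_add by (rule cc_eq_add)
lift_definition fcm_mult :: "fcm_int \<Rightarrow> fcm_int \<Rightarrow> fcm_int" is fp_mult by (rule cc_eq_mult)
lift_definition fcm_neg :: "fcm_int \<Rightarrow> fcm_int" is fp_neg by (rule cc_eq_neg)
lift_definition fcm_inv :: "fcm_int \<Rightarrow> fcm_int" is fp_inv by (rule cc_eq_inv)

definition F_cm_int :: "fcm_int cm_algebra" where
  "F_cm_int = \<lparr>cm_zero = fcm_frac 0 1, cm_one = fcm_frac 1 1, cm_err = fcm_frac 1 0,
    cm_neg = fcm_neg, cm_inv = fcm_inv, cm_add = fcm_add, cm_mult = fcm_mult\<rparr>"

datatype rat_a = Rat rat | Err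

fun ra_neg :: "rat_a \<Rightarrow> rat_a" where
  "ra_neg (Rat x) = Rat (- x)"
| "ra_neg Err = Err"

fun ra_inv :: "rat_a \<Rightarrow> rat_a" where
  "ra_inv (Rat x) = (if x = 0 then Err else Rat (inverse x))"
| "ra_inv Err = Err"

fun ra_add :: "rat_a \<Rightarrow> rat_a \<Rightarrow> rat_a" where
  "ra_add (Rat x) (Rat y) = Rat (x + y)"
| "ra_add _ _ = Err"

fun ra_mult :: "rat_a \<Rightarrow> rat_a \<Rightarrow> rat_a" where
  "ra_mult (Rat x) (Rat y) = Rat (x * y)"
| "ra_mult _ _ = Err"

definition Q_a :: "rat_a cm_algebra" where
  "Q_a = \<lparr>cm_zero = Rat 0, cm_one = Rat 1, cm_err = Err,
    cm_neg = ra_neg, cm_inv = ra_inv, cm_add = ra_add, cm_mult = ra_mult\<rparr>"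

end

theory Submission
  imports Defs
begin

text \<open>In \<open>F_cm_int\<close> one has \<open>p/q = p/1 * inv (q/1)\<close>, and the elements \<open>p/1\<close> are generated from
  \<open>1\<close> by addition and negation. So a homomorphism into \<open>Q_a\<close> must send \<open>p/q\<close> to the rational
  \<open>p/q\<close> if \<open>q \<noteq> 0\<close> and to \<open>a\<close> otherwise; this is invariant under cc-equivalence. It is not
  injective since \<open>0/1\<close> and \<open>0/2\<close> have the same image, whereas cc-equivalence preserves the
  parity of denominators.\<close>

lemmas F_cm_int_simps = F_cm_int_def cm_algebra.simps
lemmas Q_a_simps = Q_a_def cm_algebra.simps

lemma fcm_frac_cases: obtains p q where "X = fcm_frac p q"
proof -
  have "\<exists>p q. X = fcm_frac p q"
    by transfer (metis cc_eq.refl surj_pair)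
  then show thesis using that by blast
qed

lemma fcm_frac_ops [simp]:
  "fcm_add (fcm_frac x y) (fcm_frac u v) = fcm_frac (x * v + u * y) (y * v)"
  "fcm_mult (fcm_frac x y) (fcm_frac u v) = fcm_frac (x * u) (y * v)"
  "fcm_neg (fcm_frac x y) = fcm_frac (- x) y"
  "fcm_inv (fcm_frac x y) = fcm_frac (y * y) (x * y)"
  by (transfer; simp add: cc_eq.refl)+

text \<open>The generating relation with its shape moved into equations, so that \<open>z\<close>
  and \<open>y\<close> can be supplied and only polynomial identities remain.\<close>

lemma fcm_frac_cancel:
  assumes "a = c * z" "b = y * (z * z)" "d = y * z"
  shows "fcm_frac a b = fcm_frac c d"
  using assms by transfer (auto intro: cc_eq.cancel)

text \<open>Cancellation with \<open>z = 0\<close> reads 0/0 = c/0 for every c, so all fractions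
  with denominator 0 coincide with 0/0.\<close>

lemma fcm_frac_zero_denom: "fcm_frac x 0 = fcm_frac 1 0"
  by (metis fcm_frac_cancel mult_zero_right)

text \<open>Most axioms hold already between fracpairs. Cases 4, 8, 10, 11 and 12 need one surplus
  factor of the denominator cancelled; 16 and 17 compare fractions with denominator 0.\<close>

lemma common_meadow_F_cm_int: "common_meadow F_cm_int"
proof (unfold_locales, unfold F_cm_int_simps, goal_cases)
  case (1 X Y Z)
  then show ?case
    by (cases X rule: fcm_frac_cases; cases Y rule: fcm_frac_cases; cases Z rule: fcm_frac_cases)
      (simp add: algebra_simps)
next
  case (2 X Y)
  then show ?case
    by (cases X rule: fcm_frac_cases; cases Y rule: fcm_frac_cases) (simp add: ac_simps)
next
  case (3 X)
  then show ?case by (cases X rule: fcm_frac_cases) simp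
next
  case (4 X)
  obtain x y where X: "X = fcm_frac x y" by (rule fcm_frac_cases)
  show ?case unfolding X by (simp, rule fcm_frac_cancel[where z = y and y = 1]) auto
next
  case (5 X Y Z)
  then show ?case
    by (cases X rule: fcm_frac_cases; cases Y rule: fcm_frac_cases; cases Z rule: fcm_frac_cases)
      (simp add: ac_simps)
next
  case (6 X Y)
  then show ?case
    by (cases X rule: fcm_frac_cases; cases Y rule: fcm_frac_cases) (simp add: ac_simps)
next
  case (7 X)
  then show ?case by (cases X rule: fcm_frac_cases) simp
next
  case (8 X Y Z)
  obtain x y u v w t where "X = fcm_frac x y" "Y = fcm_frac u v" "Z = fcm_frac w t"
    by (metis fcm_frac_cases)
  moreover have "fcm_frac (x * u * (y * t) + x * w * (y * v)) (y * v * (y * t)) =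
      fcm_frac (x * (u * t + w * v)) (y * (v * t))"
    by (rule fcm_frac_cancel[where z = y and y = "v * t"]) (auto simp: algebra_simps)
  ultimately show ?case by simp
next
  case (9 X)
  then show ?case by (cases X rule: fcm_frac_cases) simp
next
  case (10 X)
  obtain x y where X: "X = fcm_frac x y" by (rule fcm_frac_cases)
  show ?case unfolding X by (simp, rule fcm_frac_cancel[where z = y and y = 1]) auto
next
  case (11 X)
  obtain x y where X: "X = fcm_frac x y" by (rule fcm_frac_cases)
  \<comment> \<open>The left side is the double inverse of x/y. The right side is x/y + 0/(x * y),
    where the second summand only multiplies numerator and denominator by x * y.\<close>
  have "fcm_frac (x * y * (x * y)) (y * y * (x * y)) = fcm_frac (x * (x * y)) (y * (x * y))"
    by (rule fcm_frac_cancel[where z = y and y = "x * y"]) (auto simp: algebra_simps)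
  then show ?case unfolding X by simp
next
  case (12 X)
  obtain x y where X: "X = fcm_frac x y" by (rule fcm_frac_cases)
  show ?case unfolding X
    by (simp, rule fcm_frac_cancel[where z = y and y = x]) (auto simp: algebra_simps)
next
  case (13 X Y)
  then show ?case
    by (cases X rule: fcm_frac_cases; cases Y rule: fcm_frac_cases) (simp add: ac_simps)
next
  case (16 X)
  then show ?case by (cases X rule: fcm_frac_cases) (simp, rule fcm_frac_zero_denom)
next
  case (17 X)
  then show ?case by (cases X rule: fcm_frac_cases) (simp, rule fcm_frac_zero_denom)
qed simp_all

lemma common_meadow_Q_a: "common_meadow Q_a"
proof (unfold_locales, unfold Q_a_simps, goal_cases)
  case (1 X Y Z)
  then show ?case by (cases X; cases Y; cases Z) auto
next
  case (2 X Y)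
  then show ?case by (cases X; cases Y) auto
next
  case (5 X Y Z)
  then show ?case by (cases X; cases Y; cases Z) auto
next
  case (6 X Y)
  then show ?case by (cases X; cases Y) auto
next
  case (8 X Y Z)
  then show ?case by (cases X; cases Y; cases Z) (auto simp: algebra_simps)
next
  case (13 X Y)
  then show ?case by (cases X; cases Y) auto
next
  case (4 X)
  then show ?case by (cases X) auto
next
  case (10 X)
  then show ?case by (cases X) auto
next
  case (11 X)
  then show ?case by (cases X) auto
next
  case (12 X)
  then show ?case by (cases X) auto
next
  case (3 X)
  then show ?case by (cases X) auto
next
  case (7 X)
  then show ?case by (cases X) auto
next
  case (9 X)
  then show ?case by (cases X) auto
qed simp_all

fun rat_of_fracpair :: "fracpair \<Rightarrow> rat_a" where
  "rat_of_fracpair (x, y) = (if y = 0 then Err else Rat (of_int x / of_int y))"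

text \<open>In a generating pair, both denominators vanish if \<open>y\<close> or \<open>z\<close>
  is 0; otherwise \<open>z\<close> cancels in the rationals.\<close>

lemma rat_of_fracpair_cc_eq: "cc_eq p q \<Longrightarrow> rat_of_fracpair p = rat_of_fracpair q"
  by (induction rule: cc_eq.induct) auto

lift_definition rat_of_fcm :: "fcm_int \<Rightarrow> rat_a" is rat_of_fracpair
  by (rule rat_of_fracpair_cc_eq)

lemma rat_of_fcm_frac [simp]:
  "rat_of_fcm (fcm_frac x y) = (if y = 0 then Err else Rat (of_int x / of_int y))"
  by transfer simp

text \<open>The integers have no zero divisors, so a product of denominators vanishes iff a factor
  does, which matches the absorption by \<open>Err\<close>. Likewise the denominator x * y of an
  inverse vanishes iff x/y maps to 0 or \<open>Err\<close>.\<close>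

lemma common_meadow_hom_rat_of_fcm: "common_meadow_hom F_cm_int Q_a rat_of_fcm"
proof (intro common_meadow_hom.intro common_meadow_hom_axioms.intro
    common_meadow_F_cm_int common_meadow_Q_a, unfold F_cm_int_simps Q_a_simps, goal_cases)
  case (4 X)
  then show ?case by (cases X rule: fcm_frac_cases) auto
next
  case (5 X)
  then show ?case by (cases X rule: fcm_frac_cases) auto
next
  case (6 X Y)
  then show ?case
    by (cases X rule: fcm_frac_cases; cases Y rule: fcm_frac_cases) (auto simp: field_simps)
next
  case (7 X Y)
  then show ?case by (cases X rule: fcm_frac_cases; cases Y rule: fcm_frac_cases) auto
qed auto

lemma common_meadow_hom_unique:
  assumes "common_meadow_hom F_cm_int Q_a f"
  shows "f = rat_of_fcm"
proof
  interpret common_meadow_hom F_cm_int Q_a f by fact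
  note hom = hom_zero hom_one hom_neg hom_inv hom_add hom_mult
  note hom' = hom[unfolded F_cm_int_simps Q_a_simps]
  have f_nat: "f (fcm_frac (int n) 1) = Rat (of_nat n)" for n
  proof (induction n)
    case 0
    show ?case using hom'(1) by simp
  next
    case (Suc n)
    then show ?case
      using hom'(5)[of "fcm_frac (int n) 1" "fcm_frac 1 1"] hom'(2) by (simp add: add.commute)
  qed
  have f_int: "f (fcm_frac p 1) = Rat (of_int p)" for p
  proof (cases p)
    case (nonneg n)
    then show ?thesis using f_nat by simp
  next
    \<comment> \<open>Here \<open>p\<close> is the negative of \<open>int (Suc n)\<close>, hence the
      successor below.\<close>
    case (neg n)
    then show ?thesis
      using hom'(3)[of "fcm_frac (int (Suc n)) 1"] f_nat[of "Suc n"] by simp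
  qed
  show "f X = rat_of_fcm X" for X
  proof -
    obtain p q where X: "X = fcm_frac p q" by (rule fcm_frac_cases)
    \<comment> \<open>This covers \<open>q = 0\<close> too: the inverse of 0/1 is 1/0, and
      \<open>ra_inv\<close> sends 0 to \<open>Err\<close>.\<close>
    have "X = fcm_mult (fcm_frac p 1) (fcm_inv (fcm_frac q 1))"
      unfolding X by simp
    then have "f X = ra_mult (Rat (of_int p)) (ra_inv (Rat (of_int q)))"
      by (simp only: hom' f_int)
    then show ?thesis unfolding X by (simp add: field_simps)
  qed
qed

lemma surj_rat_of_fcm: "surj rat_of_fcm"
proof (unfold surj_def, rule allI)
  fix r
  show "\<exists>X. r = rat_of_fcm X"
  proof (cases r)
    case (Rat s)
    obtain p q where "s = of_int p / of_int q" "q > 0"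
      by (cases s) (simp add: Fract_of_int_quotient)
    then have "r = rat_of_fcm (fcm_frac p q)" using Rat by simp
    then show ?thesis ..
  next
    case Err
    then have "r = rat_of_fcm (fcm_frac 1 0)" by simp
    then show ?thesis ..
  qed
qed

text \<open>The denominators y * (z * z) and y * z of a generating pair have the same prime
  divisors, in particular 2.\<close>

lemma cc_eq_even_denom: "cc_eq p q \<Longrightarrow> even (snd p) = even (snd q)"
  by (induction rule: cc_eq.induct) auto

lemma not_inj_rat_of_fcm: "\<not> inj rat_of_fcm"
proof
  assume "inj rat_of_fcm"
  then have "fcm_frac 0 1 = fcm_frac 0 2"
    by (rule injD) simp
  then have "cc_eq (0, 1) (0, 2)"
    by transfer
  then show False
    using cc_eq_even_denom by fastforce
qed

theorem corollary2p3p3: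
  shows "(\<exists>!f. common_meadow_hom F_cm_int Q_a f)
    \<and> (\<forall>f. common_meadow_hom F_cm_int Q_a f \<longrightarrow> surj f \<and> \<not> inj f)
    \<and> proper_hom_preimage F_cm_int Q_a"
  unfolding proper_hom_preimage_def
  using common_meadow_hom_rat_of_fcm common_meadow_hom_unique surj_rat_of_fcm not_inj_rat_of_fcm
  by blast

end
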